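(* There is an absolute constant $c_0>0$ such that for every constant $C>0$ there is a constant $c>0$ for which the following holds. For all integers $d\ge 1$, all $\gamma,\alpha,\xi\in(0,c_0]$ and all $\epsilon\in(0,C]$: every $\epsilon$-DP $(\gamma,0.9\gamma)$-robust learner (possibly improper) in dimension $d$, with accuracy parameter $\alpha$ and failure probability $\xi$, has sample complexity $n\ge c\, d/\epsilon$.
   Context: Let $\mathbb{B}^d=\{\mathbf{x}\in\mathbb{R}^d:\|\mathbf{x}\|_2\le 1\}$. For $\mathbf{w}\in\mathbb{R}^d$ the halfspace $h_{\mathbf{w}}:\mathbb{B}^d\to\{\pm1\}$ is $h_{\mathbf{w}}(\mathbf{x})=\operatorname{sgn}(\langle \mathbf{w},\mathbf{x}\rangle)$, with $\operatorname{sgn}(t)=+1$ for $t\ge 0$ and $-1$ for $t<0$. For $\gamma\ge 0$, a hypothesis $h:\mathbb{B}^d\to\{\pm1\}$ and a distribution $\mathcal{D}$ on $\mathbb{B}^d\times\{\pm1\}$, the robust risk is $\mathcal{R}_\gamma(h,\mathcal{D})=\Pr_{(\mathbf{x},y)\sim\mathcal{D}}[\exists \mathbf{z}\in\mathbb{B}^d:\ \|\mathbf{z}-\mathbf{x}\|_2\le\gamma,\ h(\mathbf{z})\ne y]$. $\mathcal{D}$ is $\gamma$-realizable if there is $\mathbf{w}^*\in\mathbb{R}^d$ with $\mathcal{R}_\gamma(h_{\mathbf{w}^*},\mathcal{D})=0$. A learner is a randomized algorithm $\mathbb{A}$ that takes a finite dataset (of any size) of labelled points in $\mathbb{B}^d\times\{\pm1\}$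 and outputs a hypothesis $h:\mathbb{B}^d\to\{\pm1\}$. It is a $(\gamma,\gamma')$-robust learner with accuracy $\alpha$, failure probability $\xi$ and sample complexity $n$ if, for every $\gamma$-realizable $\mathcal{D}$, when run on $n$ i.i.d. samples from $\mathcal{D}$ it outputs, with probability at least $1-\xi$, a hypothesis $h$ with $\mathcal{R}_{\gamma'}(h,\mathcal{D})\le\alpha$. It is proper if its output is always a halfspace $h_{\mathbf{w}}$; otherwise it is improper. Relevant events are assumed measurable. Two datasets are neighbors if one results from the other by adding or removing a single data point. A randomized algorithm $\mathbb{A}$ is $(\epsilon,\delta)$-DP if for all neighboring datasets $\mathbf{X},\mathbf{X}'$ and all sets $S$ of outputs, $\Pr[\mathbb{A}(\mathbf{X})\in S]\le e^{\epsilon}\Pr[\mathbb{A}(\mathbf{X}')\in S]+\delta$; $\epsilon$-DP means $(\epsilon,0)$-DP. *)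

theory Defs
  imports "HOL-Probability.Probability"
begin

text \<open>The constants of the theorem are uniform in the dimension, so the dimension has to be a term:
  vectors are functions that are \<^const>\<open>undefined\<close> outside of \<open>{..<d}\<close>.\<close>

definition unit_ball :: "nat \<Rightarrow> (nat \<Rightarrow> real) set" where
  "unit_ball d = {x \<in> {..<d} \<rightarrow>\<^sub>E UNIV. L2_set x {..<d} \<le> 1}"

definition labels :: "int set" where
  "labels = {-1, 1}"

definition example_space :: "nat \<Rightarrow> ((nat \<Rightarrow> real) \<times> int) measure" where
  "example_space d =
     restrict_space (\<Pi>\<^sub>M i\<in>{..<d}. borel) (unit_ball d) \<Otimes>\<^sub>M count_space labels"

definition hypotheses :: "nat \<Rightarrow> ((nat \<Rightarrow> real) \<Rightarrow> int) set" where
  "hypotheses d = unit_ball d \<rightarrow>\<^sub>E labels"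

text \<open>The library function \<^const>\<open>sgn\<close> vanishes at \<open>0\<close>; here the sign of \<open>0\<close> is \<open>1\<close>.\<close>

definition halfspace :: "nat \<Rightarrow> (nat \<Rightarrow> real) \<Rightarrow> (nat \<Rightarrow> real) \<Rightarrow> int" where
  "halfspace d w = (\<lambda>x\<in>unit_ball d. if (\<Sum>i<d. w i * x i) \<ge> 0 then 1 else -1)"

definition robust_error ::
  "nat \<Rightarrow> real \<Rightarrow> ((nat \<Rightarrow> real) \<Rightarrow> int) \<Rightarrow> ((nat \<Rightarrow> real) \<times> int) set" where
  "robust_error d \<gamma> h =
     {(x, y). x \<in> unit_ball d \<and> y \<in> labels \<and>
        (\<exists>z\<in>unit_ball d. L2_set (\<lambda>i. z i - x i) {..<d} \<le> \<gamma> \<and> h z \<noteq> y)}"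

definition robust_risk ::
  "nat \<Rightarrow> real \<Rightarrow> ((nat \<Rightarrow> real) \<Rightarrow> int) \<Rightarrow> ((nat \<Rightarrow> real) \<times> int) measure \<Rightarrow> real" where
  "robust_risk d \<gamma> h D = measure D (robust_error d \<gamma> h)"

text \<open>No measurability condition is needed in the next definition: for a halfspace, the sets
  of misclassified points are relatively open or closed in the compact unit ball, hence
  sigma-compact, and so are their closed neighbourhoods of radius \<open>\<gamma>\<close>.\<close>

definition realizable :: "nat \<Rightarrow> real \<Rightarrow> ((nat \<Rightarrow> real) \<times> int) measure \<Rightarrow> bool" where
  "realizable d \<gamma> D \<longleftrightarrow>
     (\<exists>w \<in> {..<d} \<rightarrow>\<^sub>E UNIV. robust_risk d \<gamma> (halfspace d w) D = 0)"

type_synonym dataset = "((nat \<Rightarrow> real) \<times> int) list"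

text \<open>A randomized algorithm is a Markov kernel from datasets of each size to hypotheses. The measurable
  space \<open>H\<close> of possible outputs belongs to the algorithm: no particular sigma-algebra
  on the set of hypotheses is singled out, and measures in \<open>prob_algebra H\<close> need not be discrete.\<close>

definition randomized_algorithm ::
  "nat \<Rightarrow> ((nat \<Rightarrow> real) \<Rightarrow> int) measure \<Rightarrow> (dataset \<Rightarrow> ((nat \<Rightarrow> real) \<Rightarrow> int) measure) \<Rightarrow> bool" where
  "randomized_algorithm d H A \<longleftrightarrow>
     space H \<subseteq> hypotheses d \<and>
     (\<forall>m. (\<lambda>\<omega>. A (map \<omega> [0..<m])) \<in> (\<Pi>\<^sub>M i\<in>{..<m}. example_space d) \<rightarrow>\<^sub>M prob_algebra H)"

text \<open>Datasets are ordered, and a data point may be inserted or deleted at any position. Algorithms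
  on multisets are the special case where \<open>A\<close> factors through \<^const>\<open>mset\<close>.\<close>

definition neighbors :: "dataset \<Rightarrow> dataset \<Rightarrow> bool" where
  "neighbors X X' \<longleftrightarrow>
     (\<exists>us p vs. (X = us @ vs \<and> X' = us @ p # vs) \<or> (X = us @ p # vs \<and> X' = us @ vs))"

definition differentially_private ::
  "nat \<Rightarrow> ((nat \<Rightarrow> real) \<Rightarrow> int) measure \<Rightarrow> real \<Rightarrow> real \<Rightarrow>
     (dataset \<Rightarrow> ((nat \<Rightarrow> real) \<Rightarrow> int) measure) \<Rightarrow> bool" where
  "differentially_private d H \<epsilon> \<delta> A \<longleftrightarrow>
     (\<forall>X \<in> lists (unit_ball d \<times> labels). \<forall>X' \<in> lists (unit_ball d \<times> labels).
        neighbors X X' \<longrightarrow>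
        (\<forall>S \<in> sets H. measure (A X) S \<le> exp \<epsilon> * measure (A X') S + \<delta>))"

text \<open>The first two conjuncts express that the events whose probabilities are taken are measurable;
  without them, \<^const>\<open>measure\<close> would return the junk value \<open>0\<close>. The measure
  in the last one is the law of the output when the input is \<open>n\<close> i.i.d. samples from \<open>D\<close>.\<close>

definition robust_learner ::
  "nat \<Rightarrow> real \<Rightarrow> real \<Rightarrow> real \<Rightarrow> real \<Rightarrow> nat \<Rightarrow> ((nat \<Rightarrow> real) \<Rightarrow> int) measure \<Rightarrow>
     (dataset \<Rightarrow> ((nat \<Rightarrow> real) \<Rightarrow> int) measure) \<Rightarrow> bool" where
  "robust_learner d \<gamma> \<gamma>' \<alpha> \<xi> n H A \<longleftrightarrow>
     (\<forall>h \<in> space H. robust_error d \<gamma>' h \<in> sets (example_space d)) \<and>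
     (\<forall>D \<in> space (prob_algebra (example_space d)). realizable d \<gamma> D \<longrightarrow>
        {h \<in> space H. robust_risk d \<gamma>' h D \<le> \<alpha>} \<in> sets H \<and>
        measure ((\<Pi>\<^sub>M i\<in>{..<n}. D) \<bind> (\<lambda>\<omega>. A (map \<omega> [0..<n])))
          {h \<in> space H. robust_risk d \<gamma>' h D \<le> \<alpha>} \<ge> 1 - \<xi>)"

end

theory Submission imports Defs begin

text \<open>Packing argument. For \<open>S \<subseteq> {..<d}\<close> let \<open>v\<^sub>S \<in> \<real>\<^sup>d\<close> be the sign vector of \<open>S\<close>, scaled to
  norm \<open>1.03 * \<gamma>\<close>, and let \<open>D\<^sub>S\<close> be uniform on \<open>(v\<^sub>S, 1)\<close> and \<open>(- v\<^sub>S, -1)\<close>. It is \<open>\<gamma>\<close>-realized by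
  the halfspace of \<open>v\<^sub>S\<close>, and a hypothesis of \<open>0.9 * \<gamma>\<close>-robust risk below \<open>1/2\<close> is \<open>1\<close> on the ball
  of radius \<open>0.9 * \<gamma>\<close> about \<open>v\<^sub>S\<close> and \<open>-1\<close> on the one about \<open>- v\<^sub>S\<close>. If \<open>S\<close> and \<open>T\<close> differ in at
  least \<open>d/4\<close> places then \<open>(v\<^sub>S - v\<^sub>T) / 2\<close> has distance at most \<open>0.9 * \<gamma>\<close> from both \<open>v\<^sub>S\<close> and
  \<open>- v\<^sub>T\<close>, so no hypothesis is good for both \<open>D\<^sub>S\<close> and \<open>D\<^sub>T\<close>. By the Gilbert-Varshamov bound
  there are exponentially many such sets. Privacy makes each of the disjoint sets of good hypotheses
  have probability at least \<open>(1 - \<xi>) * exp (- n * \<epsilon>)\<close> on the empty dataset.\<close>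

section \<open>A Gilbert-Varshamov packing\<close>

text \<open>Take \<open>F\<close> maximal among the separated subsets of \<open>V\<close>. A point
  close to no member of \<open>F\<close> could be added to it, so the balls around \<open>F\<close>
  cover \<open>V\<close>; counting gives the bound.\<close>

lemma ex_separated_subset:
  fixes close :: "'a \<Rightarrow> 'a \<Rightarrow> bool"
  assumes fin: "finite V" and refl: "\<And>x. x \<in> V \<Longrightarrow> close x x"
    and sym: "\<And>x y. close x y \<Longrightarrow> close y x"
    and ball: "\<And>x. x \<in> V \<Longrightarrow> real (card {y \<in> V. close x y}) \<le> N"
  shows "\<exists>F\<subseteq>V. (\<forall>x\<in>F. \<forall>y\<in>F. x \<noteq> y \<longrightarrow> \<not> close x y) \<and> real (card V) \<le> real (card F) * N"
proof -
  define P where "P = {F \<in> Pow V. \<forall>x\<in>F. \<forall>y\<in>F. x \<noteq> y \<longrightarrow> \<not> close x y}"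
  have "finite P" "{} \<in> P"
    using fin by (auto simp: P_def)
  then obtain F where "F \<in> P" and max: "\<And>G. G \<in> P \<Longrightarrow> F \<subseteq> G \<Longrightarrow> F = G"
    using finite_has_maximal[of P] by blast
  then have F: "F \<subseteq> V" "\<And>x y. x \<in> F \<Longrightarrow> y \<in> F \<Longrightarrow> x \<noteq> y \<Longrightarrow> \<not> close x y"
    by (auto simp: P_def)
  have cover: "V \<subseteq> (\<Union>x\<in>F. {y \<in> V. close x y})"
  proof
    fix y assume y: "y \<in> V"
    show "y \<in> (\<Union>x\<in>F. {y \<in> V. close x y})"
    proof (rule ccontr)
      assume n: "y \<notin> (\<Union>x\<in>F. {y \<in> V. close x y})"
      then have nc: "\<not> close x y \<and> \<not> close y x" if "x \<in> F" for x
        using y sym that by blast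
      then have "insert y F \<in> P"
        using F y by (auto simp: P_def)
      then have "y \<in> F"
        using max[of "insert y F"] by blast
      then show False
        using nc refl y by blast
    qed
  qed
  have finF: "finite F"
    using F(1) fin by (rule finite_subset)
  have "card V \<le> card (\<Union>x\<in>F. {y \<in> V. close x y})"
    using cover fin finF by (intro card_mono) auto
  also have "\<dots> \<le> (\<Sum>x\<in>F. card {y \<in> V. close x y})"
    by (rule card_UN_le[OF finF])
  finally have "real (card V) \<le> (\<Sum>x\<in>F. real (card {y \<in> V. close x y}))"
    by (metis of_nat_le_iff of_nat_sum)
  also have "\<dots> \<le> real (card F) * N"
    using F ball by (intro sum_bounded_above) auto
  finally show ?thesis
    using F by blast
qed

lemma sum_power_card_Pow:
  fixes t :: "'b::comm_semiring_1"
  assumes "finite A"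
  shows "(\<Sum>S\<in>Pow A. t ^ card S) = (1 + t) ^ card A"
  using prod_add[OF assms, of "\<lambda>_. t" "\<lambda>_. 1"] by (simp add: add.commute)

text \<open>Exponential weights: give \<open>T\<close> the weight
  \<open>(1 / 4) ^ card (sym_diff S T)\<close>. Members of the ball weigh at least
  \<open>s ^ d\<close> each, and all subsets together weigh \<open>(1 + 1 / 4) ^ d\<close>.\<close>

lemma card_hamming_ball_le:
  assumes S: "S \<subseteq> {..<d}"
  shows "real (card {T \<in> Pow {..<d}. 4 * card (sym_diff S T) < d}) \<le> (5 / 4 * sqrt 2) ^ d"
proof -
  let ?B = "{T \<in> Pow {..<d}. 4 * card (sym_diff S T) < d}"
  \<comment> \<open>The fourth root of 1/4, matching the radius \<open>d / 4\<close>.\<close>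
  define s :: real where "s = 1 / sqrt 2"
  have s: "0 < s" "s \<le> 1"
    unfolding s_def by auto
  have "s ^ 4 = (s\<^sup>2)\<^sup>2"
    by (simp flip: power_mult)
  then have s4: "s ^ 4 = 1 / 4"
    by (simp add: s_def power_divide)
  have "real (card ?B) * s ^ d = (\<Sum>T\<in>?B. s ^ d)"
    by simp
  also have "\<dots> \<le> (\<Sum>T\<in>?B. (1 / 4) ^ card (sym_diff S T))"
  proof (rule sum_mono)
    fix T assume "T \<in> ?B"
    then have "s ^ d \<le> s ^ (4 * card (sym_diff S T))"
      using s by (intro power_decreasing) auto
    then show "s ^ d \<le> (1 / 4) ^ card (sym_diff S T)"
      by (simp add: power_mult s4)
  qed
  also have "\<dots> \<le> (\<Sum>T\<in>Pow {..<d}. (1 / 4) ^ card (sym_diff S T))"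
    by (rule sum_mono2) auto
  \<comment> \<open>\<open>sym_diff S\<close> is an involution of \<open>Pow {..<d}\<close>, so the
    ball may be centred at the empty set.\<close>
  also have "\<dots> = (\<Sum>T\<in>Pow {..<d}. (1 / 4) ^ card T)"
    using S by (intro sum.reindex_bij_witness[where i = "sym_diff S" and j = "sym_diff S"]) auto
  also have "\<dots> = (5 / 4) ^ d"
    by (subst sum_power_card_Pow) auto
  finally have "real (card ?B) * s ^ d \<le> (5 / 4) ^ d" .
  then have "real (card ?B) \<le> (5 / 4) ^ d / s ^ d"
    using s by (simp add: pos_le_divide_eq)
  also have "\<dots> = (5 / 4 * sqrt 2) ^ d"
    by (simp add: s_def power_divide power_mult_distrib)
  finally show ?thesis .
qed

lemma gilbert_varshamov:
  obtains F where "F \<subseteq> Pow {..<d}"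
    and "\<And>S T. S \<in> F \<Longrightarrow> T \<in> F \<Longrightarrow> S \<noteq> T \<Longrightarrow> d \<le> 4 * card (sym_diff S T)"
    and "(8 / (5 * sqrt 2)) ^ d \<le> real (card F)"
\<comment> \<open>The relation \<open>close\<close> below is strict, hence reflexive only for
  positive \<open>d\<close>.\<close>
proof (cases "d = 0")
  case True
  then show thesis
    by (intro that[of "{{}}"]) auto
next
  case False
  define close where "close S T \<longleftrightarrow> 4 * card (sym_diff S T) < d" for S T :: "nat set"
  have "\<exists>F\<subseteq>Pow {..<d}. (\<forall>x\<in>F. \<forall>y\<in>F. x \<noteq> y \<longrightarrow> \<not> close x y) \<and>
      real (card (Pow {..<d})) \<le> real (card F) * (5 / 4 * sqrt 2) ^ d"
    using False card_hamming_ball_le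
    by (intro ex_separated_subset) (auto simp: close_def Un_commute)
  then obtain F where F: "F \<subseteq> Pow {..<d}" "\<And>S T. S \<in> F \<Longrightarrow> T \<in> F \<Longrightarrow> S \<noteq> T \<Longrightarrow> \<not> close S T"
    and c: "2 ^ d \<le> real (card F) * (5 / 4 * sqrt 2) ^ d"
    by (auto simp: card_Pow)
  have "(8 / (5 * sqrt 2)) ^ d = (2 / (5 / 4 * sqrt 2)) ^ d"
    by simp
  also have "\<dots> = 2 ^ d / (5 / 4 * sqrt 2) ^ d"
    by (rule power_divide)
  also have "\<dots> \<le> real (card F)"
    using c by (subst pos_divide_le_eq) auto
  finally show thesis
    using F by (intro that[of F]) (auto simp: close_def not_less)
qed

section \<open>Two-point distributions on sign vectors\<close>

definition sign_vector :: "nat \<Rightarrow> real \<Rightarrow> nat set \<Rightarrow> nat \<Rightarrow> real" where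
  "sign_vector d r S = (\<lambda>i\<in>{..<d}. if i \<in> S then r else - r)"

lemma L2_set_sign_vector: "L2_set (sign_vector d r S) {..<d} = \<bar>r\<bar> * sqrt d"
proof -
  have "L2_set (sign_vector d r S) {..<d} = L2_set (\<lambda>_. r) {..<d}"
    by (simp add: L2_set_def sign_vector_def if_distrib[of "\<lambda>x. x\<^sup>2"] cong: if_cong)
  then show ?thesis
    by (simp add: L2_set_def real_sqrt_mult mult.commute)
qed

lemma sign_vector_in_unit_ball:
  "\<bar>r\<bar> * sqrt d \<le> 1 \<Longrightarrow> sign_vector d r S \<in> unit_ball d"
  unfolding unit_ball_def by (simp add: L2_set_sign_vector) (simp add: sign_vector_def)

text \<open>Label \<open>b\<close> with the sign vector of scale \<open>b * r\<close>: negation is the change of sign of the scale.\<close>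

definition labelled_point :: "nat \<Rightarrow> real \<Rightarrow> nat set \<Rightarrow> bool \<Rightarrow> (nat \<Rightarrow> real) \<times> int" where
  "labelled_point d r S b = (if b then (sign_vector d r S, 1) else (sign_vector d (- r) S, -1))"

text \<open>Pushing a fair coin forward into \<open>example_space d\<close> yields the sigma-algebra
  that a learner's distributions must carry.\<close>

definition two_point :: "nat \<Rightarrow> real \<Rightarrow> nat set \<Rightarrow> ((nat \<Rightarrow> real) \<times> int) measure" where
  "two_point d r S =
     distr (measure_pmf (pmf_of_set UNIV)) (example_space d) (labelled_point d r S)"

lemma space_example_space: "space (example_space d) = unit_ball d \<times> labels"
  by (auto simp: example_space_def space_pair_measure space_restrict_space space_PiM unit_ball_def)

lemma sets_two_point: "sets (two_point d r S) = sets (example_space d)"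
  by (simp add: two_point_def)

lemma labelled_point_in_space:
  "\<bar>r\<bar> * sqrt d \<le> 1 \<Longrightarrow> labelled_point d r S b \<in> space (example_space d)"
  by (auto simp: space_example_space labelled_point_def labels_def sign_vector_in_unit_ball)

lemma two_point_in_prob_algebra:
  assumes "\<bar>r\<bar> * sqrt d \<le> 1"
  shows "two_point d r S \<in> space (prob_algebra (example_space d))"
  using labelled_point_in_space[OF assms]
  by (auto simp: space_prob_algebra sets_two_point two_point_def
      intro!: measure_pmf.prob_space_distr)

lemma measure_two_point:
  assumes "\<bar>r\<bar> * sqrt d \<le> 1" and "E \<in> sets (example_space d)"
  shows "measure (two_point d r S) E = real (card {b. labelled_point d r S b \<in> E}) / 2"
proof -
  have "measure (two_point d r S) E =
      measure (measure_pmf (pmf_of_set UNIV)) (labelled_point d r S -` E \<inter> UNIV)"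
    unfolding two_point_def using labelled_point_in_space[OF assms(1)] assms(2)
    by (subst measure_distr) auto
  also have "\<dots> = real (card {b. labelled_point d r S b \<in> E}) / 2"
    by (subst measure_pmf_of_set) (auto simp: vimage_def)
  finally show ?thesis .
qed

text \<open>The inner product is exactly \<open>r * d\<close> at the sign vector itself;
  Cauchy-Schwarz bounds the deviation.\<close>

lemma inner_sign_vector_near:
  assumes near: "L2_set (\<lambda>i. z i - sign_vector d r S i) {..<d} \<le> \<gamma>"
  shows "\<bar>(\<Sum>i<d. sign_vector d 1 S i * z i) - r * d\<bar> \<le> sqrt d * \<gamma>"
proof -
  have "r * d = (\<Sum>i<d. sign_vector d 1 S i * sign_vector d r S i)"
    by (simp add: sign_vector_def if_distrib[of "\<lambda>x. x * _"] cong: if_cong)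
  then have "(\<Sum>i<d. sign_vector d 1 S i * z i) - r * d =
      (\<Sum>i<d. sign_vector d 1 S i * (z i - sign_vector d r S i))"
    by (simp add: sum_subtractf right_diff_distrib)
  also have "\<bar>\<dots>\<bar> \<le> (\<Sum>i<d. \<bar>sign_vector d 1 S i\<bar> * \<bar>z i - sign_vector d r S i\<bar>)"
    by (intro order.trans[OF sum_abs]) (simp add: abs_mult)
  also have "\<dots> \<le> L2_set (sign_vector d 1 S) {..<d} * L2_set (\<lambda>i. z i - sign_vector d r S i) {..<d}"
    by (rule L2_set_mult_ineq)
  also have "\<dots> \<le> sqrt d * \<gamma>"
    using near by (auto simp: L2_set_sign_vector intro: mult_left_mono)
  finally show ?thesis .
qed

text \<open>The normal \<open>sign_vector d 1 S\<close> works: moving by \<gamma> changes the inner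
  product by at most \<open>sqrt d * \<gamma>\<close>, which is less than \<open>r * d\<close>.
  Strictness matters at the negative point, since the sign of 0 is 1.\<close>

lemma two_point_realizable:
  assumes d: "d \<ge> 1" and r: "\<bar>r\<bar> * sqrt d \<le> 1" and margin: "\<gamma> < r * sqrt d"
  shows "realizable d \<gamma> (two_point d r S)"
proof -
  let ?w = "sign_vector d 1 S" and ?E = "robust_error d \<gamma> (halfspace d (sign_vector d 1 S))"
  have lt: "sqrt d * \<gamma> < r * d"
    using margin d mult_strict_left_mono[of \<gamma> "r * sqrt d" "sqrt d"] by (simp add: algebra_simps)
  have "labelled_point d r S b \<notin> ?E" for b
  proof (cases b)
    case True
    have "halfspace d ?w z = 1"
      if "z \<in> unit_ball d" "L2_set (\<lambda>i. z i - sign_vector d r S i) {..<d} \<le> \<gamma>" for z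
      using inner_sign_vector_near[OF that(2)] that(1) lt by (auto simp: halfspace_def)
    then show ?thesis
      using True by (auto simp: labelled_point_def robust_error_def)
  next
    case False
    have "halfspace d ?w z = -1"
      if "z \<in> unit_ball d" "L2_set (\<lambda>i. z i - sign_vector d (- r) S i) {..<d} \<le> \<gamma>" for z
      using inner_sign_vector_near[OF that(2)] that(1) lt by (auto simp: halfspace_def)
    then show ?thesis
      using False by (auto simp: labelled_point_def robust_error_def)
  qed
  \<comment> \<open>If \<open>?E\<close> is measurable, it misses both atoms; otherwise
    \<open>measure\<close> has the default value 0.\<close>
  then have "robust_risk d \<gamma> (halfspace d ?w) (two_point d r S) = 0"
    unfolding robust_risk_def
    using measure_two_point[OF r, of ?E S] measure_notin_sets[of ?E "two_point d r S"]
    by (cases "?E \<in> sets (example_space d)") (auto simp: sets_two_point)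
  moreover have "?w \<in> {..<d} \<rightarrow>\<^sub>E UNIV"
    by (auto simp: sign_vector_def)
  ultimately show ?thesis
    unfolding realizable_def by blast
qed

text \<open>Each labelled point has mass 1/2, so a smaller risk excludes both from the error
  set.\<close>

lemma robust_on_two_point:
  assumes r: "\<bar>r\<bar> * sqrt d \<le> 1" and meas: "robust_error d \<gamma> h \<in> sets (example_space d)"
    and risk: "robust_risk d \<gamma> h (two_point d r S) < 1 / 2" and z: "z \<in> unit_ball d"
  shows "L2_set (\<lambda>i. z i - sign_vector d r S i) {..<d} \<le> \<gamma> \<Longrightarrow> h z = 1"
    and "L2_set (\<lambda>i. z i - sign_vector d (- r) S i) {..<d} \<le> \<gamma> \<Longrightarrow> h z = -1"
proof -
  have "card {b. labelled_point d r S b \<in> robust_error d \<gamma> h} = 0"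
    using risk measure_two_point[OF r meas] by (simp add: robust_risk_def)
  then have no: "labelled_point d r S b \<notin> robust_error d \<gamma> h" for b
    by auto
  show "L2_set (\<lambda>i. z i - sign_vector d r S i) {..<d} \<le> \<gamma> \<Longrightarrow> h z = 1"
    using no[of True] z sign_vector_in_unit_ball[OF r]
    by (auto simp: labelled_point_def robust_error_def labels_def)
  show "L2_set (\<lambda>i. z i - sign_vector d (- r) S i) {..<d} \<le> \<gamma> \<Longrightarrow> h z = -1"
    using no[of False] z sign_vector_in_unit_ball[of "- r"] r
    by (auto simp: labelled_point_def robust_error_def labels_def)
qed

text \<open>The witness is the midpoint of the sign vector of \<open>S\<close> and the negated one
  of \<open>T\<close>. Its difference from either end vanishes on \<open>sym_diff S T\<close> and
  has entries of modulus \<open>\<bar>r\<bar>\<close> elsewhere, on at most \<open>3 / 4 * d\<close>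
  coordinates.\<close>

lemma sign_vector_midpoint:
  assumes S: "S \<subseteq> {..<d}" and T: "T \<subseteq> {..<d}" and far: "d \<le> 4 * card (sym_diff S T)"
    and r: "\<bar>r\<bar> * sqrt d \<le> 1" and \<gamma>: "0 \<le> \<gamma>" "3 * (r\<^sup>2 * d) \<le> 4 * \<gamma>\<^sup>2"
  obtains z where "z \<in> unit_ball d"
    "L2_set (\<lambda>i. z i - sign_vector d r S i) {..<d} \<le> \<gamma>"
    "L2_set (\<lambda>i. z i - sign_vector d (- r) T i) {..<d} \<le> \<gamma>"
proof -
  define z where "z = (\<lambda>i\<in>{..<d}. if i \<in> S - T then r else if i \<in> T - S then - r else 0)"
  have "L2_set z {..<d} \<le> L2_set (\<lambda>_. r) {..<d}"
    unfolding L2_set_def by (intro real_sqrt_le_mono sum_mono) (auto simp: z_def)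
  also have "\<dots> \<le> 1"
    using r by (simp add: L2_set_def real_sqrt_mult mult.commute)
  finally have 1: "z \<in> unit_ball d"
    by (auto simp: unit_ball_def z_def)
  have sub: "sym_diff S T \<subseteq> {..<d}"
    using S T by auto
  have c: "card ({..<d} - sym_diff S T) + card (sym_diff S T) = d"
    using card_Diff_subset[OF finite_subset[OF sub] sub] card_mono[OF _ sub] by simp
  have bound: "L2_set f {..<d} \<le> \<gamma>"
    if f: "\<And>i. i < d \<Longrightarrow> (f i)\<^sup>2 = (if i \<in> sym_diff S T then 0 else r\<^sup>2)" for f
  proof -
    have "(\<Sum>i<d. (f i)\<^sup>2) = (\<Sum>i<d. if i \<in> sym_diff S T then 0 else r\<^sup>2)"
      by (intro sum.cong) (auto simp: f)
    also have "\<dots> = (\<Sum>i\<in>{..<d} - sym_diff S T. r\<^sup>2)"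
      by (intro sum.mono_neutral_cong_right) auto
    also have "\<dots> = card ({..<d} - sym_diff S T) * r\<^sup>2"
      by simp
    also have "\<dots> \<le> (3 / 4 * d) * r\<^sup>2"
      using c far by (intro mult_right_mono zero_le_power2) linarith
    also have "\<dots> \<le> \<gamma>\<^sup>2"
      using \<gamma>(2) by (simp add: mult.commute mult.left_commute)
    finally show ?thesis
      unfolding L2_set_def using \<gamma>(1) by (simp add: real_le_lsqrt)
  qed
  have "L2_set (\<lambda>i. z i - sign_vector d r S i) {..<d} \<le> \<gamma>"
    "L2_set (\<lambda>i. z i - sign_vector d (- r) T i) {..<d} \<le> \<gamma>"
    by (rule bound; auto simp: z_def sign_vector_def)+
  with 1 show thesis
    by (rule that)
qed

section \<open>Private learners on separated distributions\<close>

lemma prob_space_algorithm: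
  assumes alg: "randomized_algorithm d H A" and X: "X \<in> lists (unit_ball d \<times> labels)"
  shows "prob_space (A X) \<and> sets (A X) = sets H"
proof -
  let ?\<omega> = "\<lambda>i\<in>{..<length X}. X ! i"
  have "?\<omega> \<in> space (\<Pi>\<^sub>M i\<in>{..<length X}. example_space d)"
    using X by (auto simp: space_PiM space_example_space)
  then have "A (map ?\<omega> [0..<length X]) \<in> space (prob_algebra H)"
    using alg unfolding randomized_algorithm_def by (blast dest: measurable_space)
  moreover have "map ?\<omega> [0..<length X] = X"
    by (rule nth_equalityI) auto
  ultimately show ?thesis
    by (auto simp: space_prob_algebra)
qed

text \<open>Deleting the entries one at a time costs a factor \<open>exp \<epsilon>\<close> each.
  Ending at the empty dataset gives one reference measure for all input distributions.\<close>

lemma group_privacy: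
  assumes dp: "differentially_private d H \<epsilon> 0 A" and G: "G \<in> sets H"
  shows "X \<in> lists (unit_ball d \<times> labels) \<Longrightarrow>
    measure (A X) G \<le> exp (real (length X) * \<epsilon>) * measure (A []) G"
proof (induction X)
  case (Cons a X)
  have "neighbors (a # X) X"
    unfolding neighbors_def by (metis append_Nil)
  then have "measure (A (a # X)) G \<le> exp \<epsilon> * measure (A X) G"
    using dp Cons.prems G by (fastforce simp: differentially_private_def)
  also have "\<dots> \<le> exp \<epsilon> * (exp (real (length X) * \<epsilon>) * measure (A []) G)"
    using Cons by (intro mult_left_mono) auto
  also have "\<dots> = exp (real (length (a # X)) * \<epsilon>) * measure (A []) G"
    by (simp add: exp_add[symmetric] algebra_simps)
  finally show ?case .
qed simp

text \<open>The output law averages \<open>A\<close> over samples of size \<open>n\<close>, and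
  group privacy bounds each term by the same constant.\<close>

lemma private_output_bound:
  assumes alg: "randomized_algorithm d H A" and dp: "differentially_private d H \<epsilon> 0 A"
    and D: "D \<in> space (prob_algebra (example_space d))" and G: "G \<in> sets H"
  shows "measure ((\<Pi>\<^sub>M i\<in>{..<n}. D) \<bind> (\<lambda>\<omega>. A (map \<omega> [0..<n]))) G
    \<le> exp (real n * \<epsilon>) * measure (A []) G"
proof -
  let ?P = "\<Pi>\<^sub>M i\<in>{..<n}. D" and ?f = "\<lambda>\<omega>. A (map \<omega> [0..<n])"
  have setsD: "sets D = sets (example_space d)" and "prob_space D"
    using D by (auto simp: space_prob_algebra)
  then interpret P: prob_space ?P
    by (intro prob_space_PiM)
  have "sets ?P = sets (\<Pi>\<^sub>M i\<in>{..<n}. example_space d)"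
    by (intro sets_PiM_cong) (auto simp: setsD)
  then have f: "?f \<in> ?P \<rightarrow>\<^sub>M prob_algebra H"
    using alg by (simp add: randomized_algorithm_def cong: measurable_cong_sets)
  have bound: "measure (?f \<omega>) G \<le> exp (real n * \<epsilon>) * measure (A []) G" if "\<omega> \<in> space ?P" for \<omega>
  proof -
    have "\<omega> \<in> {..<n} \<rightarrow>\<^sub>E unit_ball d \<times> labels"
      using that unfolding space_PiM sets_eq_imp_space_eq[OF setsD] space_example_space .
    then have "set (map \<omega> [0..<n]) \<subseteq> unit_ball d \<times> labels"
      unfolding set_map by (intro image_subsetI PiE_mem[of \<omega>]) auto
    then have "map \<omega> [0..<n] \<in> lists (unit_ball d \<times> labels)"
      unfolding lists_eq_set by (rule CollectI)
    from group_privacy[OF dp G this] show ?thesis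
      by simp
  qed
  have "measure (?P \<bind> ?f) G = (\<integral>\<omega>. measure (?f \<omega>) G \<partial>?P)"
    by (rule P.measure_bind[OF measurable_prob_algebraD[OF f] G])
  also have "\<dots> \<le> exp (real n * \<epsilon>) * measure (A []) G"
  proof (rule P.integral_le_const)
    have p: "prob_space (?f \<omega>)" if "\<omega> \<in> space ?P" for \<omega>
      using measurable_space[OF f that] by (simp add: space_prob_algebra)
    show "integrable ?P (\<lambda>\<omega>. measure (?f \<omega>) G)"
      using measurable_compose[OF f measurable_measure_prob_algebra[OF G]] p
      by (intro P.integrable_const_bound[of _ 1]) (auto intro!: AE_I2 prob_space.prob_le_1)
  qed (use bound in \<open>auto intro: AE_I2\<close>)
  finally show ?thesis .
qed

text \<open>The events \<open>G S\<close> are disjoint under the single probability measure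
  \<open>A []\<close>, so their probabilities, each at least
  \<open>p * exp (- (n * \<epsilon>))\<close>, sum to at most 1.\<close>

lemma private_packing_bound:
  assumes alg: "randomized_algorithm d H A" and dp: "differentially_private d H \<epsilon> 0 A"
    and fin: "finite F"
    and D: "\<And>S. S \<in> F \<Longrightarrow> D S \<in> space (prob_algebra (example_space d))"
    and G: "\<And>S. S \<in> F \<Longrightarrow> G S \<in> sets H" and disj: "disjoint_family_on G F"
    and succ: "\<And>S. S \<in> F \<Longrightarrow>
      p \<le> measure ((\<Pi>\<^sub>M i\<in>{..<n}. D S) \<bind> (\<lambda>\<omega>. A (map \<omega> [0..<n]))) (G S)"
  shows "real (card F) * p \<le> exp (real n * \<epsilon>)"
proof -
  interpret A0: prob_space "A []"
    using prob_space_algorithm[OF alg, of "[]"] by auto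
  have sets: "G ` F \<subseteq> sets (A [])"
    using prob_space_algorithm[OF alg, of "[]"] G by auto
  have "real (card F) * p = (\<Sum>S\<in>F. p)"
    by simp
  also have "\<dots> \<le> (\<Sum>S\<in>F. exp (real n * \<epsilon>) * measure (A []) (G S))"
    by (intro sum_mono order.trans[OF succ private_output_bound[OF alg dp D G]])
  also have "\<dots> = exp (real n * \<epsilon>) * measure (A []) (\<Union>S\<in>F. G S)"
    using A0.finite_measure_finite_Union[OF fin sets disj] by (simp add: sum_distrib_left)
  also have "\<dots> \<le> exp (real n * \<epsilon>)"
    using A0.prob_le_1 by (simp add: mult_left_le)
  finally show ?thesis .
qed

section \<open>Choice of constants and assembly of the lower bound\<close>

theorem theorem2:
  "\<exists>c\<^sub>0::real. c\<^sub>0 > 0 \<and> (\<forall>C::real. C > 0 \<longrightarrow> (\<exists>c::real. c > 0 \<and>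
     (\<forall>(d::nat) (\<gamma>::real) (\<alpha>::real) (\<xi>::real) (\<epsilon>::real) (n::nat) H A.
        d \<ge> 1 \<longrightarrow> \<gamma> \<in> {0<..c\<^sub>0} \<longrightarrow> \<alpha> \<in> {0<..c\<^sub>0} \<longrightarrow> \<xi> \<in> {0<..c\<^sub>0} \<longrightarrow> \<epsilon> \<in> {0<..C} \<longrightarrow>
        randomized_algorithm d H A \<longrightarrow>
        differentially_private d H \<epsilon> 0 A \<longrightarrow>
        robust_learner d \<gamma> (0.9 * \<gamma>) \<alpha> \<xi> n H A \<longrightarrow>
        real n \<ge> c * real d / \<epsilon>)))"
proof -
  \<comment> \<open>The growth rate of the Gilbert-Varshamov packing, about 1.13.\<close>
  define q :: real where "q = 8 / (5 * sqrt 2)"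
  have "sqrt 2 < 8 / 5"
    by (rule real_less_lsqrt) (auto simp: power2_eq_square)
  then have q: "q > 1"
    by (simp add: q_def field_simps)
  \<comment> \<open>The threshold 1/4 keeps \<open>1.03 * \<gamma>\<close> below 1, \<alpha> below
    the atom mass 1/2, and the success probability at least 3/4.\<close>
  have main: "ln q / 2 * real d / \<epsilon> \<le> real n"
    if d: "d \<ge> 1" and \<gamma>: "\<gamma> \<in> {0<..1/4}" and \<alpha>: "\<alpha> \<in> {0<..1/4}" and \<xi>: "\<xi> \<in> {0<..1/4}"
      and \<epsilon>: "\<epsilon> > 0" and alg: "randomized_algorithm d H A"
      and dp: "differentially_private d H \<epsilon> 0 A"
      and learner: "robust_learner d \<gamma> (0.9 * \<gamma>) \<alpha> \<xi> n H A"
    for d n :: nat and \<gamma> \<alpha> \<xi> \<epsilon> :: real and H A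
  proof -
    \<comment> \<open>The norm \<open>r * sqrt d\<close> must exceed \<gamma> for realizability and
      be at most \<open>2 / sqrt 3 * 0.9 * \<gamma>\<close>, about \<open>1.039 * \<gamma>\<close>,
      for the midpoint to be near both ends; 1.03 lies in this window.\<close>
    define r where "r = 1.03 * \<gamma> / sqrt d"
    have rd: "r * sqrt d = 1.03 * \<gamma>" and "r > 0"
      using d \<gamma> by (auto simp: r_def)
    then have r: "\<bar>r\<bar> * sqrt d \<le> 1" and margin: "\<gamma> < r * sqrt d"
      using \<gamma> by auto
    have "r\<^sup>2 * d = (r * sqrt d)\<^sup>2"
      by (simp add: power_mult_distrib)
    also have "\<dots> = 10609 / 10000 * \<gamma>\<^sup>2"
      by (simp add: rd power_mult_distrib power_divide)
    finally have "r\<^sup>2 * d = 10609 / 10000 * \<gamma>\<^sup>2" .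
    moreover have "(0.9 * \<gamma>)\<^sup>2 = 81 / 100 * \<gamma>\<^sup>2"
      by (simp add: power_mult_distrib power_divide)
    ultimately have r2: "3 * (r\<^sup>2 * d) \<le> 4 * (0.9 * \<gamma>)\<^sup>2"
      using zero_le_power2[of \<gamma>] by linarith
    obtain F where F: "F \<subseteq> Pow {..<d}"
      and far: "\<And>S T. S \<in> F \<Longrightarrow> T \<in> F \<Longrightarrow> S \<noteq> T \<Longrightarrow> d \<le> 4 * card (sym_diff S T)"
      and card: "q ^ d \<le> real (card F)"
      using gilbert_varshamov[of d] unfolding q_def by metis
    have fin: "finite F"
      using F by (rule finite_subset) simp
    define G where "G S = {h \<in> space H. robust_risk d (0.9 * \<gamma>) h (two_point d r S) \<le> \<alpha>}" for S
    have D: "two_point d r S \<in> space (prob_algebra (example_space d))"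
      and "realizable d \<gamma> (two_point d r S)" for S
      by (rule two_point_in_prob_algebra[OF r], rule two_point_realizable[OF d r margin])
    then have G: "G S \<in> sets H" and succ: "1 - \<xi> \<le>
        measure ((\<Pi>\<^sub>M i\<in>{..<n}. two_point d r S) \<bind> (\<lambda>\<omega>. A (map \<omega> [0..<n]))) (G S)" for S
      using learner unfolding robust_learner_def G_def by blast+
    have disj: "disjoint_family_on G F"
      unfolding disjoint_family_on_def
    proof (intro ballI impI equals0I)
      fix S T h assume ST: "S \<in> F" "T \<in> F" "S \<noteq> T" and h: "h \<in> G S \<inter> G T"
      have "S \<subseteq> {..<d}" "T \<subseteq> {..<d}"
        using F ST by auto
      then obtain z where z: "z \<in> unit_ball d"
        "L2_set (\<lambda>i. z i - sign_vector d r S i) {..<d} \<le> 0.9 * \<gamma>"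
        "L2_set (\<lambda>i. z i - sign_vector d (- r) T i) {..<d} \<le> 0.9 * \<gamma>"
        using sign_vector_midpoint[OF _ _ far[OF ST] r _ r2] \<gamma> by auto
      have meas: "robust_error d (0.9 * \<gamma>) h \<in> sets (example_space d)"
        using learner h unfolding robust_learner_def G_def by blast
      have risk: "robust_risk d (0.9 * \<gamma>) h (two_point d r U) < 1 / 2" if "U \<in> {S, T}" for U
        using h \<alpha> that by (auto simp: G_def)
      \<comment> \<open>The point \<open>z\<close> is near the positive point for \<open>S\<close>
        and the negative point for \<open>T\<close>.\<close>
      have "h z = 1" "h z = -1"
        using robust_on_two_point[OF r meas risk z(1)] z(2,3) by blast+
      then show False
        by simp
    qed
    have "card F * (1 - \<xi>) \<le> exp (real n * \<epsilon>)"
      by (rule private_packing_bound[OF alg dp fin D G disj succ])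
    moreover have "card F * (3 / 4) \<le> card F * (1 - \<xi>)"
      using \<xi> by (intro mult_left_mono) auto
    ultimately have packing: "card F * (3 / 4) \<le> exp (real n * \<epsilon>)"
      by linarith
    \<comment> \<open>As \<open>d \<ge> 1\<close>, integrality gives at least two packing members,
      so the bound has content even in small dimensions.\<close>
    have "1 < q ^ d"
      using q d by simp
    with card have "1 < real (card F)"
      by linarith
    then have K: "real (card F) \<ge> 2"
      by simp
    \<comment> \<open>Since \<open>K := card F \<ge> 2\<close>, the factor \<open>3/4\<close> costs at most a square root: \<open>K \<le> (3 K / 4)\<^sup>2\<close>.\<close>
    have "exp (ln q * d) = q ^ d"
      using q by (simp add: exp_of_nat2_mult)
    also have "\<dots> \<le> (card F * (3 / 4))\<^sup>2"
    proof -
      have "2 * real (card F) \<le> real (card F) * real (card F)"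
        using K by (intro mult_right_mono) auto
      then show ?thesis
        using card unfolding power2_eq_square by linarith
    qed
    also have "\<dots> \<le> (exp (real n * \<epsilon>))\<^sup>2"
      using packing by (intro power_mono) auto
    also have "\<dots> = exp (2 * (n * \<epsilon>))"
      by (simp add: exp_double)
    finally have "ln q * d \<le> 2 * (n * \<epsilon>)"
      by simp
    then show ?thesis
      using \<epsilon> by (simp add: field_simps)
  qed
  have "ln q / 2 > 0"
    using q by simp
  then show ?thesis
    by (intro exI[of _ "1/4"] conjI allI impI exI[of _ "ln q / 2"] main) auto
qed

end
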